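(* Let $V$ be a finite dimensional real inner product space, let $K$ be a self-dual cone in $V$, and let $e\in K^\circ$. Suppose $L$ is a $Z$-transformation on $K$ with $v(L,e)=0$ and that $L$ is space-irreducible (relative to $K$). Then the following statements hold: (a) $L$ is almost monotone, that is, $L(x)\ge 0\Rightarrow L(x)=0$ (for $x\in V$). (b) $L$ is trivially range monotone, that is, $L^2(x)\ge 0\Rightarrow L(x)=0$ (for $x\in V$). (c) $\ker(L^2)=\ker(L)$. (d) The group inverse of $L$ exists.
   Context: $V$ is a finite dimensional real inner product space with inner product $\langle\cdot,\cdot\rangle$. A cone $K\subseteq V$ is proper if it is a pointed closed convex cone with nonempty interior $K^\circ$. Its dual is $K^*=\{x\in V:\langle x,y\rangle\ge 0\ \forall y\in K\}$; $K$ is self-dual if $K=K^*$ (a self-dual cone is proper). We write $x\ge 0$ for $x\in K$. Linear game: for $e\in K^\circ$ let $\Delta(e)=\{x\in K:\langle x,e\rangle=1\}$. For a linear transformation $L:V\to V$, the value of the game $(L,e)$ is $v(L,e)=\max_{x\in\Delta(e)}\min_{y\in\Delta(e)}\langle L(x),y\rangle=\min_{y\in\Delta(e)}\max_{x\in\Delta(e)}\langle L(x),y\rangle$. A linear transformation $L$ on $V$ is a $Z$-transformation on $K$ if $x\in K$, $y\in K^*$, $\langle x,y\rangle=0$ imply $\langle L(x),y\rangle\le 0$. A face of $K$ is a convex cone $F\subseteq K$ such that if $a\in F$ and $a=b+c$ with $b,c\in K$, then $b,c\in F$. $L$ is space-irreducible (relative to $K$) if whenever $F$ is a face of $K$ with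 $L(F-F)\subseteq F-F$, then $F=\{0\}$ or $F=K$. The group inverse of $L$ is a linear transformation $X$ on $V$ with $LXL=L$, $XLX=X$, $LX=XL$. *)

theory Defs
  imports "HOL-Analysis.Analysis"
begin

definition dual_cone :: "'a::euclidean_space set \<Rightarrow> 'a set"
  where "dual_cone K = {x. \<forall>y\<in>K. 0 \<le> x \<bullet> y}"

(* A dual cone is automatically a closed convex cone containing 0, so these properties are
   not listed separately. *)
definition self_dual_cone :: "'a::euclidean_space set \<Rightarrow> bool"
  where "self_dual_cone K \<longleftrightarrow> K = dual_cone K"

definition strategies :: "'a::euclidean_space set \<Rightarrow> 'a \<Rightarrow> 'a set"
  where "strategies K e = {x \<in> K. x \<bullet> e = 1}"

(* For a proper self-dual cone K, linear L and e in the interior of K, the set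
   strategies K e is nonempty and compact, so INF and SUP are attained, i.e. they are the min
   and max of the game; by the minimax theorem the two operations may be interchanged. *)
definition game_value :: "'a::euclidean_space set \<Rightarrow> ('a \<Rightarrow> 'a) \<Rightarrow> 'a \<Rightarrow> real"
  where "game_value K L e = (SUP x\<in>strategies K e. INF y\<in>strategies K e. L x \<bullet> y)"

definition Z_transformation :: "'a::euclidean_space set \<Rightarrow> ('a \<Rightarrow> 'a) \<Rightarrow> bool"
  where "Z_transformation K L \<longleftrightarrow>
    linear L \<and> (\<forall>x\<in>K. \<forall>y\<in>dual_cone K. x \<bullet> y = 0 \<longrightarrow> L x \<bullet> y \<le> 0)"

(* cone {} holds in the library, while a convex cone here contains 0; hence F = {} is
   excluded explicitly. Otherwise {} would be an invariant face of every K. *)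
definition cone_face :: "'a::euclidean_space set \<Rightarrow> 'a set \<Rightarrow> bool"
  where "cone_face F K \<longleftrightarrow>
    F \<noteq> {} \<and> cone F \<and> convex F \<and> F \<subseteq> K \<and>
    (\<forall>a\<in>F. \<forall>b\<in>K. \<forall>c\<in>K. a = b + c \<longrightarrow> b \<in> F \<and> c \<in> F)"

(* F - F in the sense of Minkowski; the infix minus on sets is the set difference. *)
definition minkowski_diff :: "'a::euclidean_space set \<Rightarrow> 'a set \<Rightarrow> 'a set"
  where "minkowski_diff A B = {a - b | a b. a \<in> A \<and> b \<in> B}"

definition space_irreducible :: "'a::euclidean_space set \<Rightarrow> ('a \<Rightarrow> 'a) \<Rightarrow> bool"
  where "space_irreducible K L \<longleftrightarrow>
    (\<forall>F. cone_face F K \<and> L ` minkowski_diff F F \<subseteq> minkowski_diff F F \<longrightarrow> F = {0} \<or> F = K)"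

definition is_group_inverse :: "('a::euclidean_space \<Rightarrow> 'a) \<Rightarrow> ('a \<Rightarrow> 'a) \<Rightarrow> bool"
  where "is_group_inverse L X \<longleftrightarrow>
    linear X \<and> L \<circ> X \<circ> L = L \<and> X \<circ> L \<circ> X = X \<and> L \<circ> X = X \<circ> L"

end

theory Submission
  imports Defs
begin

text \<open>
  The idea is to work with resolvents. If \<open>L\<close> is a Z-transformation and \<open>t\<close> is large, then
  \<open>t I + L\<close> is invertible and its inverse maps \<open>K\<close> into \<open>K\<close>
  (\<open>Z_transformation_resolvent\<close>). If \<open>0 \<noteq> u \<in> K\<close> satisfies \<open>L u + s u \<ge> 0\<close> for some real \<open>s\<close>,
  this inverse maps \<open>u\<close> below a multiple of \<open>u\<close>, so it preserves the face generated by \<open>u\<close>. The span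
  of that face is then invariant under the inverse, by finite dimension under \<open>t I + L\<close>, and hence
  under \<open>L\<close>. Irreducibility makes the face all of \<open>K\<close>, that is, \<open>u\<close> is an interior point
  (\<open>irreducible_subinvariant_interior\<close>).

  The value \<open>0\<close> enters twice: there is \<open>0 \<noteq> p \<in> K\<close> with \<open>L p \<ge> 0\<close>, and there is no \<open>x \<in> K\<close> with
  \<open>L x\<close> in the interior. If \<open>L p\<close> were nonzero, applying the resolvent to \<open>p\<close> would smear \<open>L p\<close> into an
  interior point, against the second fact; so \<open>L p = 0\<close>, and \<open>p\<close> is interior. Now let \<open>L x \<ge> 0\<close>. Moving
  from \<open>x\<close> along \<open>p\<close> to the boundary of \<open>K\<close> gives a boundary point \<open>w\<close> with \<open>L w = L x \<ge> 0\<close>, and a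
  nonzero such point would be interior; so \<open>w = 0\<close> and \<open>x\<close> is a multiple of \<open>p\<close>
  (\<open>preimage_of_cone_is_line\<close>). All four statements follow from this.
\<close>

section \<open>Self-dual cones with interior\<close>

lemma self_dual_cone_mem_iff:
  assumes "self_dual_cone K"
  shows "x \<in> K \<longleftrightarrow> (\<forall>y\<in>K. 0 \<le> x \<bullet> y)"
  using assms unfolding self_dual_cone_def dual_cone_def by blast

lemma self_dual_cone_zero:
  assumes "self_dual_cone K"
  shows "0 \<in> K"
  by (subst self_dual_cone_mem_iff[OF assms]) simp

lemma self_dual_cone_add:
  assumes "self_dual_cone K" "x \<in> K" "y \<in> K"
  shows "x + y \<in> K"
  using assms(2,3) unfolding self_dual_cone_mem_iff[OF assms(1)]
  by (simp add: inner_add_left)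

lemma self_dual_cone_scaleR:
  assumes "self_dual_cone K" "x \<in> K" "0 \<le> c"
  shows "c *\<^sub>R x \<in> K"
  using assms(2,3) unfolding self_dual_cone_mem_iff[OF assms(1)]
  by simp

lemma self_dual_cone_pointed:
  assumes "self_dual_cone K" "x \<in> K" "- x \<in> K"
  shows "x = 0"
proof -
  have "0 \<le> (- x) \<bullet> x"
    using assms self_dual_cone_mem_iff by blast
  then have "\<not> 0 < x \<bullet> x" by (simp add: not_less del: inner_gt_zero_iff)
  then show ?thesis unfolding inner_gt_zero_iff by blast
qed

lemma self_dual_cone_closed:
  assumes "self_dual_cone K"
  shows "closed K"
proof -
  have "K = (\<Inter>y\<in>K. {x. 0 \<le> y \<bullet> x})"
    by (rule set_eqI, subst self_dual_cone_mem_iff[OF assms]) (auto simp: inner_commute)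
  also have "closed \<dots>"
    by (intro closed_INT ballI closed_halfspace_ge)
  finally show ?thesis .
qed

text \<open>The radius \<open>r\<close> of a ball around \<open>e\<close> inside \<open>K\<close> serves: \<open>e - r y / norm y\<close> lies in \<open>K\<close>, so its
  inner product with \<open>y\<close> is nonnegative.\<close>

lemma interior_inner_lower_bound:
  assumes "self_dual_cone K" "e \<in> interior K"
  obtains r where "0 < r" "\<And>y. y \<in> K \<Longrightarrow> r * norm y \<le> y \<bullet> e"
proof -
  obtain r where r: "0 < r" "cball e r \<subseteq> K"
    using assms(2) by (auto simp: mem_interior_cball)
  have "r * norm y \<le> y \<bullet> e" if y: "y \<in> K" for y
  proof (cases "y = 0")
    case False
    have "e - (r / norm y) *\<^sub>R y \<in> cball e r"
      using r(1) False by (simp add: dist_norm)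
    then have "0 \<le> (e - (r / norm y) *\<^sub>R y) \<bullet> y"
      using r(2) y self_dual_cone_mem_iff[OF assms(1)] by blast
    also have "\<dots> = y \<bullet> e - r * norm y"
      using False by (simp add: inner_diff_left inner_commute[of e] dot_square_norm power2_eq_square)
    finally show ?thesis by simp
  qed simp
  with r(1) show ?thesis using that by blast
qed

lemma interior_inner_pos:
  assumes "self_dual_cone K" "e \<in> interior K" "y \<in> K" "y \<noteq> 0"
  shows "0 < y \<bullet> e"
proof -
  obtain r where r: "0 < r" "\<And>y. y \<in> K \<Longrightarrow> r * norm y \<le> y \<bullet> e"
    using interior_inner_lower_bound[OF assms(1,2)] by blast
  have "0 < r * norm y" using r(1) assms(4) by simp
  with r(2)[OF assms(3)] show ?thesis by linarith
qed

lemma interior_dominating: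
  assumes K: "self_dual_cone K" and e: "e \<in> interior K"
    and c: "0 < c" and d: "c *\<^sub>R u - e \<in> K"
  shows "u \<in> interior K"
proof -
  obtain r where r: "0 < r" "ball e r \<subseteq> K"
    using e by (auto simp: mem_interior)
  have "ball u (r / c) \<subseteq> K"
  proof
    fix v assume "v \<in> ball u (r / c)"
    then have "norm (u - v) * c < r"
      using c by (simp add: dist_norm pos_less_divide_eq)
    moreover have "dist e (e + c *\<^sub>R (v - u)) = norm (u - v) * c"
      using c by (simp add: dist_norm norm_minus_commute)
    ultimately have "e + c *\<^sub>R (v - u) \<in> ball e r" by simp
    then have "(e + c *\<^sub>R (v - u)) + (c *\<^sub>R u - e) \<in> K"
      using r(2) d self_dual_cone_add[OF K] by blast
    then have "c *\<^sub>R v \<in> K" by (simp add: algebra_simps)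
    then have "inverse c *\<^sub>R (c *\<^sub>R v) \<in> K"
      using self_dual_cone_scaleR[OF K, of "c *\<^sub>R v" "inverse c"] c by simp
    then show "v \<in> K" using c by simp
  qed
  then show ?thesis using r(1) c by (meson divide_pos_pos mem_interior)
qed

lemma interior_perturbation:
  fixes K :: "'a::euclidean_space set"
  assumes "e \<in> interior K"
  obtains \<epsilon> where "0 < \<epsilon>" "e + \<epsilon> *\<^sub>R v \<in> interior K"
proof -
  have "((\<lambda>\<epsilon>. e + \<epsilon> *\<^sub>R v) \<longlongrightarrow> e + 0 *\<^sub>R v) (at_right 0)"
    by (intro tendsto_intros)
  then have "\<forall>\<^sub>F \<epsilon> in at_right 0. e + \<epsilon> *\<^sub>R v \<in> interior K"
    using assms by (intro topological_tendstoD) auto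
  moreover have "\<forall>\<^sub>F \<epsilon>::real in at_right 0. 0 < \<epsilon>"
    by (simp add: eventually_at_right_less)
  ultimately have "\<forall>\<^sub>F \<epsilon> in at_right 0. 0 < \<epsilon> \<and> e + \<epsilon> *\<^sub>R v \<in> interior K"
    by eventually_elim simp
  then have "\<exists>\<epsilon>. 0 < \<epsilon> \<and> e + \<epsilon> *\<^sub>R v \<in> interior K"
    using eventually_happens'[OF trivial_limit_at_right_real] by blast
  then show ?thesis using that by blast
qed

lemma strategies_compact:
  assumes "self_dual_cone K" "e \<in> interior K"
  shows "compact (strategies K e)"
proof -
  obtain r where r: "0 < r" "\<And>y. y \<in> K \<Longrightarrow> r * norm y \<le> y \<bullet> e"
    using interior_inner_lower_bound[OF assms] by blast
  have "strategies K e = K \<inter> {x. e \<bullet> x = 1}"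
    by (auto simp: strategies_def inner_commute)
  then have "closed (strategies K e)"
    using self_dual_cone_closed[OF assms(1)] by (simp add: closed_Int closed_hyperplane)
  moreover have "norm y \<le> 1 / r" if "y \<in> strategies K e" for y
    using r(2)[of y] that r(1) by (simp add: strategies_def field_simps)
  then have "bounded (strategies K e)"
    by (auto simp: bounded_iff)
  ultimately show ?thesis by (simp add: compact_eq_bounded_closed)
qed

lemma strategies_normalize:
  assumes "self_dual_cone K" "e \<in> interior K" "y \<in> K" "y \<noteq> 0"
  shows "(1 / (y \<bullet> e)) *\<^sub>R y \<in> strategies K e"
  using interior_inner_pos[OF assms] self_dual_cone_scaleR[OF assms(1,3)]
  by (simp add: strategies_def)

lemma strategies_nonempty:
  assumes "self_dual_cone K" "e \<in> interior K"
  shows "strategies K e \<noteq> {}"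
proof -
  obtain b :: 'a where b: "b \<in> Basis" using nonempty_Basis by blast
  obtain \<epsilon> where \<epsilon>: "0 < \<epsilon>" "e + \<epsilon> *\<^sub>R b \<in> interior K"
    using interior_perturbation[OF assms(2)] by blast
  have mem: "e \<in> K" "e + \<epsilon> *\<^sub>R b \<in> K"
    using assms(2) \<epsilon>(2) interior_subset by blast+
  have "e \<noteq> e + \<epsilon> *\<^sub>R b" using \<epsilon>(1) b nonzero_Basis by auto
  then have "e \<noteq> 0 \<or> e + \<epsilon> *\<^sub>R b \<noteq> 0" by metis
  then show ?thesis
    using strategies_normalize[OF assms] mem by blast
qed

lemma mem_cone_if_strategies:
  assumes K: "self_dual_cone K" and e: "e \<in> interior K"
    and nn: "\<And>y. y \<in> strategies K e \<Longrightarrow> 0 \<le> x \<bullet> y"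
  shows "x \<in> K"
proof -
  have "0 \<le> x \<bullet> y" if y: "y \<in> K" for y
  proof (cases "y = 0")
    case False
    have "0 \<le> x \<bullet> ((1 / (y \<bullet> e)) *\<^sub>R y)"
      using nn strategies_normalize[OF K e y False] by blast
    then show ?thesis
      using interior_inner_pos[OF K e y False] by (simp add: zero_le_divide_iff)
  qed simp
  then show ?thesis using self_dual_cone_mem_iff[OF K] by blast
qed

text \<open>Every line in the direction of an interior point \<open>e\<close> meets the boundary of \<open>K\<close>. The strategy \<open>y\<close>
  that minimizes \<open>u \<bullet> y\<close> gives both the boundary point and a supporting functional there.\<close>

lemma shift_to_boundary:
  assumes K: "self_dual_cone K" and e: "e \<in> interior K"
  obtains s y where "y \<in> K" "y \<noteq> 0" "u + s *\<^sub>R e \<in> K" "(u + s *\<^sub>R e) \<bullet> y = 0"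
proof -
  have "\<exists>y\<in>strategies K e. \<forall>z\<in>strategies K e. u \<bullet> y \<le> u \<bullet> z"
    by (intro continuous_attains_inf strategies_compact[OF K e] strategies_nonempty[OF K e]
        continuous_intros)
  then obtain y where y: "y \<in> strategies K e" "\<And>z. z \<in> strategies K e \<Longrightarrow> u \<bullet> y \<le> u \<bullet> z"
    by blast
  define s where "s = - (u \<bullet> y)"
  have shift: "(u + s *\<^sub>R e) \<bullet> z = u \<bullet> z - u \<bullet> y" if "z \<in> strategies K e" for z
    using that by (simp add: s_def strategies_def inner_diff_left inner_commute[of e])
  have "u + s *\<^sub>R e \<in> K"
    using mem_cone_if_strategies[OF K e] shift y(2) by simp
  moreover have "(u + s *\<^sub>R e) \<bullet> y = 0" using shift[OF y(1)] by simp
  moreover have "y \<in> K" "y \<noteq> 0" using y(1) by (auto simp: strategies_def)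
  ultimately show ?thesis using that by blast
qed

section \<open>Resolvents of Z-transformations\<close>

text \<open>If \<open>u\<close> were outside \<open>K\<close>, one would have to move it by some \<open>s e\<close> with \<open>s > 0\<close> to reach the
  boundary. At the supporting functional \<open>y\<close> there the Z-property makes the image of the boundary
  point nonpositive, while \<open>s (t e + L e)\<close> contributes strictly positively.\<close>

lemma Z_transformation_inverse_nonneg:
  assumes K: "self_dual_cone K" and e: "e \<in> interior K" and Z: "Z_transformation K L"
    and te: "t *\<^sub>R e + L e \<in> interior K" and u: "t *\<^sub>R u + L u \<in> K"
  shows "u \<in> K"
proof (rule ccontr)
  assume "u \<notin> K"
  have lin: "linear L" using Z by (simp add: Z_transformation_def)
  obtain s y where y: "y \<in> K" "y \<noteq> 0" and w: "u + s *\<^sub>R e \<in> K" "(u + s *\<^sub>R e) \<bullet> y = 0"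
    using shift_to_boundary[OF K e] by blast
  have "s > 0"
  proof (rule ccontr)
    assume "\<not> s > 0"
    then have "(- s) *\<^sub>R e \<in> K"
      using self_dual_cone_scaleR[OF K] e interior_subset by (metis neg_0_le_iff_le not_less subsetD)
    from self_dual_cone_add[OF K w(1) this] have "u \<in> K" by simp
    with \<open>u \<notin> K\<close> show False ..
  qed
  have "y \<in> dual_cone K" using y(1) K by (simp add: self_dual_cone_def)
  then have "L (u + s *\<^sub>R e) \<bullet> y \<le> 0"
    using Z w unfolding Z_transformation_def by blast
  then have "t * ((u + s *\<^sub>R e) \<bullet> y) + L (u + s *\<^sub>R e) \<bullet> y \<le> 0" using w(2) by simp
  moreover have "t * ((u + s *\<^sub>R e) \<bullet> y) + L (u + s *\<^sub>R e) \<bullet> y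
      = (t *\<^sub>R u + L u) \<bullet> y + s * (y \<bullet> (t *\<^sub>R e + L e))"
    by (simp add: linear_add[OF lin] linear_scale[OF lin] inner_add_left inner_add_right
        inner_commute algebra_simps)
  moreover have "0 \<le> (t *\<^sub>R u + L u) \<bullet> y"
    using u y(1) self_dual_cone_mem_iff[OF K] by blast
  moreover have "0 < s * (y \<bullet> (t *\<^sub>R e + L e))"
    using \<open>s > 0\<close> interior_inner_pos[OF K te y] by simp
  ultimately show False by linarith
qed

lemma Z_transformation_resolvent:
  assumes K: "self_dual_cone K" and e: "e \<in> interior K" and Z: "Z_transformation K L"
  obtains t R where "s < t" "linear R" "inj R"
    "\<And>v. t *\<^sub>R R v + L (R v) = v" "\<And>v. R (t *\<^sub>R v + L v) = v" "\<And>v. v \<in> K \<Longrightarrow> R v \<in> K"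
proof -
  have lin: "linear L" using Z by (simp add: Z_transformation_def)
  obtain \<epsilon> where \<epsilon>: "0 < \<epsilon>" "e + \<epsilon> *\<^sub>R L e \<in> interior K"
    using interior_perturbation[OF e] by blast
  have eK: "e \<in> K" using e interior_subset by blast
  define t where "t = max (s + 1) (1 / \<epsilon>)"
  have t: "s < t" "1 / \<epsilon> \<le> t" by (auto simp: t_def)
  then have "0 \<le> \<epsilon> * t - 1" using \<epsilon>(1) by (simp add: field_simps)
  from self_dual_cone_scaleR[OF K eK this]
  have "\<epsilon> *\<^sub>R (t *\<^sub>R e + L e) - (e + \<epsilon> *\<^sub>R L e) \<in> K" by (simp add: algebra_simps)
  from interior_dominating[OF K \<epsilon>(2,1) this]
  have te: "t *\<^sub>R e + L e \<in> interior K" .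
  define M where "M = (\<lambda>v. t *\<^sub>R v + L v)"
  have linM: "linear M"
    unfolding M_def
    by (rule linearI) (simp_all add: linear_add[OF lin] linear_scale[OF lin] algebra_simps)
  have nonneg: "v \<in> K" if "M v \<in> K" for v
    using Z_transformation_inverse_nonneg[OF K e Z te, of v] that by (simp add: M_def)
  have "v = 0" if "M v = 0" for v
  proof (rule self_dual_cone_pointed[OF K])
    show "v \<in> K" using nonneg[of v] that self_dual_cone_zero[OF K] by simp
    show "- v \<in> K"
      using nonneg[of "- v"] that linear_neg[OF linM, of v] self_dual_cone_zero[OF K] by simp
  qed
  then have "inj M" by (simp add: linear_injective_0[OF linM])
  then obtain R where R: "linear R" "\<And>v. R (M v) = v" "\<And>v. M (R v) = v"
    using linear_injective_isomorphism[OF linM] by blast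
  show ?thesis
  proof (rule that)
    show "inj R" using R(3) by (metis injI)
    show "t *\<^sub>R R v + L (R v) = v" for v using R(3)[of v] by (simp add: M_def)
    show "R (t *\<^sub>R v + L v) = v" for v using R(2)[of v] by (simp add: M_def)
    show "R v \<in> K" if "v \<in> K" for v using nonneg[of "R v"] R(3)[of v] that by simp
  qed (fact t(1) R(1))+
qed

section \<open>Irreducibility\<close>

definition generated_face :: "'a::euclidean_space set \<Rightarrow> 'a \<Rightarrow> 'a set"
  where "generated_face K u = {f \<in> K. \<exists>c\<ge>0. c *\<^sub>R u - f \<in> K}"

lemma generated_face_add:
  assumes K: "self_dual_cone K" and "f \<in> generated_face K u" "g \<in> generated_face K u"
  shows "f + g \<in> generated_face K u"
proof -
  obtain c d where cd: "0 \<le> c" "0 \<le> d" "c *\<^sub>R u - f \<in> K" "d *\<^sub>R u - g \<in> K" and fg: "f \<in> K" "g \<in> K"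
    using assms(2,3) by (auto simp: generated_face_def)
  have "(c + d) *\<^sub>R u - (f + g) \<in> K"
    using self_dual_cone_add[OF K cd(3,4)] by (simp add: algebra_simps)
  moreover have "0 \<le> c + d" using cd(1,2) by simp
  ultimately show ?thesis
    using self_dual_cone_add[OF K fg] unfolding generated_face_def by blast
qed

lemma generated_face_scaleR:
  assumes K: "self_dual_cone K" and "f \<in> generated_face K u" "0 \<le> a"
  shows "a *\<^sub>R f \<in> generated_face K u"
proof -
  obtain c where c: "0 \<le> c" "c *\<^sub>R u - f \<in> K" and f: "f \<in> K"
    using assms(2) by (auto simp: generated_face_def)
  have "(a * c) *\<^sub>R u - a *\<^sub>R f \<in> K"
    using self_dual_cone_scaleR[OF K c(2) assms(3)] by (simp add: algebra_simps)
  moreover have "0 \<le> a * c" using c(1) assms(3) by simp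
  ultimately show ?thesis
    using self_dual_cone_scaleR[OF K f assms(3)] unfolding generated_face_def by blast
qed

lemma generated_face_zero:
  assumes "self_dual_cone K"
  shows "0 \<in> generated_face K u"
proof -
  have "0 *\<^sub>R u - 0 \<in> K" using self_dual_cone_zero[OF assms] by simp
  then show ?thesis
    using self_dual_cone_zero[OF assms] unfolding generated_face_def by blast
qed

lemma generated_face_self:
  assumes "self_dual_cone K" "u \<in> K"
  shows "u \<in> generated_face K u"
proof -
  have "1 *\<^sub>R u - u \<in> K" using self_dual_cone_zero[OF assms(1)] by simp
  then show ?thesis using assms(2) zero_le_one unfolding generated_face_def by blast
qed

lemma generated_face_below:
  assumes K: "self_dual_cone K" and "b \<in> K" "c \<in> K" "b + c \<in> generated_face K u"
  shows "b \<in> generated_face K u"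
proof -
  obtain d where d: "0 \<le> d" "d *\<^sub>R u - (b + c) \<in> K"
    using assms(4) by (auto simp: generated_face_def)
  have "d *\<^sub>R u - b \<in> K"
    using self_dual_cone_add[OF K d(2) assms(3)] by (simp add: algebra_simps)
  then show ?thesis using d(1) assms(2) by (auto simp: generated_face_def)
qed

lemma cone_face_generated_face:
  assumes K: "self_dual_cone K"
  shows "cone_face (generated_face K u) K"
proof -
  have "cone (generated_face K u)"
    using generated_face_scaleR[OF K] by (auto simp: cone_def)
  moreover have "convex (generated_face K u)"
    using generated_face_scaleR[OF K] generated_face_add[OF K] by (auto simp: convex_def)
  moreover have "generated_face K u \<noteq> {}" using generated_face_zero[OF K] by blast
  moreover have "generated_face K u \<subseteq> K" by (auto simp: generated_face_def)
  moreover have "b \<in> generated_face K u \<and> c \<in> generated_face K u"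
    if "b \<in> K" "c \<in> K" "b + c \<in> generated_face K u" for b c
    using generated_face_below[OF K] that by (metis add.commute)
  ultimately show ?thesis unfolding cone_face_def by blast
qed

lemma subspace_minkowski_diff_generated_face:
  assumes K: "self_dual_cone K"
  shows "subspace (minkowski_diff (generated_face K u) (generated_face K u))"
    (is "subspace (minkowski_diff ?F ?F)")
proof (rule subspaceI)
  have "(0::'a) = 0 - 0" by simp
  then show "0 \<in> minkowski_diff ?F ?F"
    using generated_face_zero[OF K] unfolding minkowski_diff_def by blast
next
  fix x y assume "x \<in> minkowski_diff ?F ?F" "y \<in> minkowski_diff ?F ?F"
  then obtain a b c d where "x = a - b" "y = c - d" and m: "a \<in> ?F" "b \<in> ?F" "c \<in> ?F" "d \<in> ?F"
    unfolding minkowski_diff_def by blast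
  then have "x + y = (a + c) - (b + d)" by simp
  then show "x + y \<in> minkowski_diff ?F ?F"
    using generated_face_add[OF K] m unfolding minkowski_diff_def by blast
next
  fix r x assume "x \<in> minkowski_diff ?F ?F"
  then obtain a b where x: "x = a - b" and m: "a \<in> ?F" "b \<in> ?F"
    unfolding minkowski_diff_def by blast
  show "r *\<^sub>R x \<in> minkowski_diff ?F ?F"
  proof (cases "0 \<le> r")
    case True
    have "r *\<^sub>R x = r *\<^sub>R a - r *\<^sub>R b" by (simp add: x algebra_simps)
    then show ?thesis
      using generated_face_scaleR[OF K] m True unfolding minkowski_diff_def by blast
  next
    case False
    have "r *\<^sub>R x = (- r) *\<^sub>R b - (- r) *\<^sub>R a" by (simp add: x algebra_simps)
    moreover have "0 \<le> - r" using False by simp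
    ultimately show ?thesis
      using generated_face_scaleR[OF K] m unfolding minkowski_diff_def by blast
  qed
qed

text \<open>With \<open>R = (t I + L)\<^sup>-\<^sup>1\<close> and \<open>t > s\<close>, the hypothesis says \<open>(t I + L) u \<ge> (t - s) u\<close>, so
  \<open>R u \<le> u / (t - s)\<close>: the face generated by \<open>u\<close> is invariant under \<open>R\<close>. Passing to its span makes the
  step from \<open>R\<close> to \<open>t I + L\<close> a dimension count.\<close>

lemma irreducible_subinvariant_interior:
  assumes K: "self_dual_cone K" and e: "e \<in> interior K" and Z: "Z_transformation K L"
    and irr: "space_irreducible K L"
    and u: "u \<in> K" "u \<noteq> 0" and sub: "L u + s *\<^sub>R u \<in> K"
  shows "u \<in> interior K"
proof -
  have lin: "linear L" using Z by (simp add: Z_transformation_def)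
  obtain t R where t: "s < t" and R: "linear R" "inj R" "\<And>v. t *\<^sub>R R v + L (R v) = v"
      "\<And>v. R (t *\<^sub>R v + L v) = v" "\<And>v. v \<in> K \<Longrightarrow> R v \<in> K"
    by (rule Z_transformation_resolvent[OF K e Z, of s]) (rule that)
  define F where "F = generated_face K u"
  define S where "S = minkowski_diff F F"
  have RF: "R f \<in> F" if f: "f \<in> F" for f
  proof -
    obtain c where c: "0 \<le> c" "c *\<^sub>R u - f \<in> K" and fK: "f \<in> K"
      using f by (auto simp: F_def generated_face_def)
    define d where "d = c / (t - s)"
    have d: "0 \<le> d" and cd: "c = d * (t - s)" using c(1) t by (auto simp: d_def)
    have "d *\<^sub>R (L u + s *\<^sub>R u) + (c *\<^sub>R u - f) \<in> K"
      using self_dual_cone_add[OF K] self_dual_cone_scaleR[OF K] sub d c(2) by blast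
    also have "d *\<^sub>R (L u + s *\<^sub>R u) + (c *\<^sub>R u - f) = d *\<^sub>R (t *\<^sub>R u + L u) - f"
      by (simp add: cd algebra_simps)
    finally have "R (d *\<^sub>R (t *\<^sub>R u + L u) - f) \<in> K" by (rule R(5))
    then have "d *\<^sub>R u - R f \<in> K"
      by (simp only: linear_diff[OF R(1)] linear_scale[OF R(1)] R(4))
    then show ?thesis using d R(5)[OF fK] by (auto simp: F_def generated_face_def)
  qed
  have RS: "R ` S \<subseteq> S"
  proof
    fix z assume "z \<in> R ` S"
    then obtain a b where "z = R (a - b)" and ab: "a \<in> F" "b \<in> F"
      unfolding S_def minkowski_diff_def by blast
    then have "z = R a - R b" by (simp add: linear_diff[OF R(1)])
    then show "z \<in> S" using RF ab unfolding S_def minkowski_diff_def by blast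
  qed
  have subS: "subspace S"
    unfolding S_def F_def by (rule subspace_minkowski_diff_generated_face[OF K])
  have "dim (R ` S) = dim S"
    using dim_image_eq[OF R(1)] R(2) by (metis inj_on_subset subset_UNIV)
  then have RS_eq: "R ` S = S"
    using subspace_dim_equal[OF linear_subspace_image[OF R(1) subS] subS RS] by simp
  have "L ` S \<subseteq> S"
  proof
    fix z assume "z \<in> L ` S"
    then obtain v where v: "v \<in> S" "z = L v" by blast
    then obtain w where w: "w \<in> S" "v = R w" using RS_eq by blast
    have "z = w - t *\<^sub>R v" using R(3)[of w] v w by (simp add: algebra_simps)
    then show "z \<in> S" using subspace_diff[OF subS w(1) subspace_scale[OF subS v(1)]] by simp
  qed
  then have "F = {0} \<or> F = K"
    using irr cone_face_generated_face[OF K, of u]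
    unfolding space_irreducible_def S_def F_def by blast
  moreover have "u \<in> F" unfolding F_def by (rule generated_face_self[OF K u(1)])
  ultimately have "F = K" using u(2) by blast
  then have "e \<in> F" using e interior_subset by blast
  then obtain c where c: "0 \<le> c" "c *\<^sub>R u - e \<in> K" by (auto simp: F_def generated_face_def)
  \<comment> \<open>\<open>c\<close> may be \<open>0\<close> here; adding a copy of \<open>u\<close> makes the factor positive.\<close>
  have "(c + 1) *\<^sub>R u - e \<in> K"
    using self_dual_cone_add[OF K c(2) u(1)] by (simp add: algebra_simps)
  then show ?thesis using interior_dominating[OF K e, of "c + 1" u] c(1) by simp
qed

section \<open>Games of value zero\<close>

lemma strategies_inner_bounded:
  fixes K :: "'a::euclidean_space set"
  assumes K: "self_dual_cone K" and e: "e \<in> interior K" and lin: "linear L"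
  obtains B where "\<And>x y. x \<in> strategies K e \<Longrightarrow> y \<in> strategies K e \<Longrightarrow> \<bar>L x \<bullet> y\<bar> \<le> B"
proof -
  obtain C where C: "\<And>y. y \<in> strategies K e \<Longrightarrow> norm y \<le> C"
    using compact_imp_bounded[OF strategies_compact[OF K e]] by (auto simp: bounded_iff)
  have "compact (L ` strategies K e)"
    by (intro compact_continuous_image linear_continuous_on strategies_compact[OF K e])
      (simp add: lin linear_conv_bounded_linear[symmetric])
  then obtain D where D: "\<And>x. x \<in> strategies K e \<Longrightarrow> norm (L x) \<le> D"
    using compact_imp_bounded[of "L ` strategies K e"] by (auto simp: bounded_iff)
  have "\<bar>L x \<bullet> y\<bar> \<le> D * C" if "x \<in> strategies K e" "y \<in> strategies K e" for x y
  proof -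
    have "\<bar>L x \<bullet> y\<bar> \<le> norm (L x) * norm y" by (rule Cauchy_Schwarz_ineq2)
    also have "\<dots> \<le> D * C"
      by (rule mult_mono[OF D[OF that(1)] C[OF that(2)] order_trans[OF norm_ge_zero D[OF that(1)]]
          norm_ge_zero])
    finally show ?thesis .
  qed
  then show ?thesis by (rule that)
qed

lemma inf_strategies_le:
  assumes K: "self_dual_cone K" and e: "e \<in> interior K" and lin: "linear L"
    and "x \<in> strategies K e" "y \<in> strategies K e"
  shows "(INF y\<in>strategies K e. L x \<bullet> y) \<le> L x \<bullet> y"
proof -
  obtain B where B: "\<And>x y. x \<in> strategies K e \<Longrightarrow> y \<in> strategies K e \<Longrightarrow> \<bar>L x \<bullet> y\<bar> \<le> B"
    using strategies_inner_bounded[OF K e lin] by blast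
  have "- B \<le> L x \<bullet> z" if "z \<in> strategies K e" for z
    using B[OF assms(4) that] by linarith
  then have "bdd_below ((\<lambda>y. L x \<bullet> y) ` strategies K e)" by (rule bdd_belowI2)
  then show ?thesis using assms(5) by (rule cINF_lower)
qed

lemma inf_strategies_le_game_value:
  assumes K: "self_dual_cone K" and e: "e \<in> interior K" and lin: "linear L"
    and x: "x \<in> strategies K e"
  shows "(INF y\<in>strategies K e. L x \<bullet> y) \<le> game_value K L e"
proof -
  obtain B where B: "\<And>x y. x \<in> strategies K e \<Longrightarrow> y \<in> strategies K e \<Longrightarrow> \<bar>L x \<bullet> y\<bar> \<le> B"
    using strategies_inner_bounded[OF K e lin] by blast
  obtain y0 where y0: "y0 \<in> strategies K e" using strategies_nonempty[OF K e] by blast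
  have "(INF y\<in>strategies K e. L x \<bullet> y) \<le> B" if "x \<in> strategies K e" for x
    using inf_strategies_le[OF K e lin that y0] B[OF that y0] by linarith
  then have "bdd_above ((\<lambda>x. INF y\<in>strategies K e. L x \<bullet> y) ` strategies K e)"
    by (rule bdd_aboveI2)
  with x show ?thesis unfolding game_value_def by (rule cSUP_upper)
qed

text \<open>Normalized to a strategy, such an \<open>x\<close> would guarantee a positive payoff.\<close>

lemma game_value_nonpos_no_interior_image:
  assumes K: "self_dual_cone K" and e: "e \<in> interior K" and lin: "linear L"
    and val: "game_value K L e \<le> 0" and x: "x \<in> K"
  shows "L x \<notin> interior K"
proof
  assume int: "L x \<in> interior K"
  obtain y0 where y0: "y0 \<in> strategies K e" using strategies_nonempty[OF K e] by blast
  then have "y0 \<in> K" "y0 \<noteq> 0" by (auto simp: strategies_def)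
  from interior_inner_pos[OF K int this] have "x \<noteq> 0"
    using linear_0[OF lin] by auto
  then have xe: "0 < x \<bullet> e" by (rule interior_inner_pos[OF K e x])
  define x' where "x' = (1 / (x \<bullet> e)) *\<^sub>R x"
  have x': "x' \<in> strategies K e"
    unfolding x'_def by (rule strategies_normalize[OF K e x \<open>x \<noteq> 0\<close>])
  obtain \<epsilon> where \<epsilon>: "0 < \<epsilon>" "L x + \<epsilon> *\<^sub>R (- e) \<in> interior K"
    using interior_perturbation[OF int] by blast
  then have dual: "\<And>y. y \<in> K \<Longrightarrow> 0 \<le> (L x + \<epsilon> *\<^sub>R (- e)) \<bullet> y"
    using interior_subset self_dual_cone_mem_iff[OF K] by blast
  have "\<epsilon> / (x \<bullet> e) \<le> L x' \<bullet> y" if y: "y \<in> strategies K e" for y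
  proof -
    have "0 \<le> (L x + \<epsilon> *\<^sub>R (- e)) \<bullet> y"
      using y by (intro dual) (simp add: strategies_def)
    also have "\<dots> = L x \<bullet> y - \<epsilon>"
      using y by (simp add: strategies_def inner_diff_left inner_commute[of e])
    finally show ?thesis
      using xe by (simp add: x'_def linear_scale[OF lin] divide_right_mono)
  qed
  then have "\<epsilon> / (x \<bullet> e) \<le> (INF y\<in>strategies K e. L x' \<bullet> y)"
    by (intro cINF_greatest strategies_nonempty[OF K e])
  also have "\<dots> \<le> 0" using inf_strategies_le_game_value[OF K e lin x'] val by linarith
  finally show False using \<epsilon>(1) xe by (simp add: divide_le_0_iff)
qed

text \<open>A strategy that guarantees more than \<open>- \<epsilon>\<close> has its image at distance at most \<open>\<epsilon> norm e\<close> from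
  \<open>K\<close>. Such strategies exist for all \<open>\<epsilon> > 0\<close>, so the minimal distance, attained by compactness,
  is zero.\<close>

lemma game_value_nonneg_optimal_strategy:
  assumes K: "self_dual_cone K" and e: "e \<in> interior K" and lin: "linear L"
    and val: "0 \<le> game_value K L e"
  obtains x where "x \<in> K" "x \<noteq> 0" "L x \<in> K"
proof -
  have "continuous_on (strategies K e) (\<lambda>x. infdist (L x) K)"
    by (intro continuous_on_infdist linear_continuous_on)
      (simp add: lin linear_conv_bounded_linear[symmetric])
  then have "\<exists>x\<in>strategies K e. \<forall>z\<in>strategies K e. infdist (L x) K \<le> infdist (L z) K"
    by (intro continuous_attains_inf strategies_compact[OF K e] strategies_nonempty[OF K e])
  then obtain x where x: "x \<in> strategies K e"
    "\<And>z. z \<in> strategies K e \<Longrightarrow> infdist (L x) K \<le> infdist (L z) K"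
    by blast
  have le: "infdist (L x) K \<le> \<epsilon> * norm e" if \<epsilon>: "0 < \<epsilon>" for \<epsilon>
  proof -
    have "- \<epsilon> < (SUP x\<in>strategies K e. INF y\<in>strategies K e. L x \<bullet> y)"
      using val \<epsilon> unfolding game_value_def by linarith
    then obtain z where z: "z \<in> strategies K e" "- \<epsilon> < (INF y\<in>strategies K e. L z \<bullet> y)"
      using less_cSupE[of "- \<epsilon>" "(\<lambda>x. INF y\<in>strategies K e. L x \<bullet> y) ` strategies K e"]
        strategies_nonempty[OF K e] by blast
    have "L z + \<epsilon> *\<^sub>R e \<in> K"
    proof (rule mem_cone_if_strategies[OF K e])
      fix y assume y: "y \<in> strategies K e"
      have "- \<epsilon> < L z \<bullet> y" using inf_strategies_le[OF K e lin z(1) y] z(2) by linarith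
      then show "0 \<le> (L z + \<epsilon> *\<^sub>R e) \<bullet> y"
        using y by (simp add: strategies_def inner_add_left inner_commute[of e])
    qed
    then have "infdist (L z) K \<le> dist (L z) (L z + \<epsilon> *\<^sub>R e)" by (rule infdist_le)
    also have "\<dots> = \<epsilon> * norm e" using \<epsilon> by (simp add: dist_norm)
    finally show ?thesis using x(2)[OF z(1)] by linarith
  qed
  have "infdist (L x) K \<le> 0"
  proof (rule field_le_epsilon)
    fix \<delta> :: real assume \<delta>: "0 < \<delta>"
    have pos: "0 < norm e + 1" using norm_ge_zero[of e] by linarith
    have "infdist (L x) K \<le> \<delta> / (norm e + 1) * norm e" using \<delta> pos by (intro le) simp
    also have "\<dots> \<le> \<delta>" using \<delta> pos by (simp add: pos_divide_le_eq distrib_left)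
    finally show "infdist (L x) K \<le> 0 + \<delta>" by simp
  qed
  then have "infdist (L x) K = 0" using infdist_nonneg[of "L x" K] by linarith
  then have "L x \<in> K"
    using in_closed_iff_infdist_zero self_dual_cone_closed[OF K] self_dual_cone_zero[OF K] by blast
  moreover have "x \<in> K" "x \<noteq> 0" using x(1) by (auto simp: strategies_def)
  ultimately show ?thesis using that by blast
qed

text \<open>The resolvent \<open>R\<close> commutes with \<open>L\<close>, so \<open>R p\<close> has image \<open>R (L p)\<close>. If \<open>L p\<close> were nonzero, this
  image \<open>u\<close> would satisfy \<open>L u + t u = L p \<ge> 0\<close> and hence be interior.\<close>

lemma nonneg_image_zero:
  assumes K: "self_dual_cone K" and e: "e \<in> interior K" and Z: "Z_transformation K L"
    and irr: "space_irreducible K L" and val: "game_value K L e \<le> 0"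
    and p: "p \<in> K" "L p \<in> K"
  shows "L p = 0"
proof (rule ccontr)
  assume nz: "L p \<noteq> 0"
  have lin: "linear L" using Z by (simp add: Z_transformation_def)
  obtain t R where "0 < t" and R: "linear R" "inj R" "\<And>v. t *\<^sub>R R v + L (R v) = v"
      "\<And>v. R (t *\<^sub>R v + L v) = v" "\<And>v. v \<in> K \<Longrightarrow> R v \<in> K"
    by (rule Z_transformation_resolvent[OF K e Z, of 0]) (rule that)
  define u where "u = R (L p)"
  have "L p = t *\<^sub>R L (R p) + L (L (R p))"
    using arg_cong[OF R(3)[of p], of L] by (simp add: linear_add[OF lin] linear_scale[OF lin])
  then have u_eq: "u = L (R p)" using R(4)[of "L (R p)"] by (simp add: u_def)
  have "u \<noteq> 0"
    using injD[OF R(2), of "L p" 0] linear_0[OF R(1)] nz unfolding u_def by metis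
  have "L u + t *\<^sub>R u \<in> K" using R(3)[of "L p"] p(2) by (simp add: u_def add.commute)
  moreover have "u \<in> K" unfolding u_def by (rule R(5)[OF p(2)])
  ultimately have "u \<in> interior K"
    using irreducible_subinvariant_interior[OF K e Z irr] \<open>u \<noteq> 0\<close> by blast
  moreover have "L (R p) \<notin> interior K"
    by (rule game_value_nonpos_no_interior_image[OF K e lin val R(5)[OF p(1)]])
  ultimately show False using u_eq by simp
qed

lemma preimage_of_cone_is_line:
  assumes K: "self_dual_cone K" and e: "e \<in> interior K" and Z: "Z_transformation K L"
    and irr: "space_irreducible K L" and val: "game_value K L e = 0"
  obtains p where "p \<in> K" "L p = 0" "\<And>x. L x \<in> K \<Longrightarrow> \<exists>c. x = c *\<^sub>R p"
proof -
  have lin: "linear L" using Z by (simp add: Z_transformation_def)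
  obtain p where p: "p \<in> K" "p \<noteq> 0" "L p \<in> K"
    using game_value_nonneg_optimal_strategy[OF K e lin] val by auto
  have Lp: "L p = 0" using nonneg_image_zero[OF K e Z irr] val p(1,3) by simp
  have int: "w \<in> interior K" if "w \<in> K" "w \<noteq> 0" "L w \<in> K" for w
    using irreducible_subinvariant_interior[OF K e Z irr that(1,2), of 0] that(3) by simp
  have "\<exists>c. x = c *\<^sub>R p" if x: "L x \<in> K" for x
  proof -
    obtain s y where y: "y \<in> K" "y \<noteq> 0" and w: "x + s *\<^sub>R p \<in> K" "(x + s *\<^sub>R p) \<bullet> y = 0"
      using shift_to_boundary[OF K int[OF p]] by blast
    have "L (x + s *\<^sub>R p) \<in> K" using x Lp by (simp add: linear_add[OF lin] linear_scale[OF lin])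
    then have "x + s *\<^sub>R p = 0"
      using int[OF w(1)] interior_inner_pos[OF K _ y] w(2) by (metis inner_commute less_irrefl)
    then have "x = (- s) *\<^sub>R p" by (simp add: eq_neg_iff_add_eq_0)
    then show ?thesis by blast
  qed
  then show ?thesis using that p(1) Lp by blast
qed

section \<open>The group inverse\<close>

text \<open>\<open>X x\<close> is the unique \<open>w\<close> in the range of \<open>L\<close> with \<open>L (L w) = L x\<close>. The
  hypothesis makes \<open>L\<close> injective on its range, hence by finite dimension a bijection of the range
  onto itself; this gives existence and uniqueness, and every identity for \<open>X\<close> follows from
  uniqueness.\<close>

lemma group_inverse_exists:
  fixes L :: "'a::euclidean_space \<Rightarrow> 'a"
  assumes lin: "linear L" and ker: "\<And>x. L (L x) = 0 \<Longrightarrow> L x = 0"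
  shows "\<exists>X. is_group_inverse L X"
proof -
  note L = linear_add[OF lin] linear_diff[OF lin] linear_scale[OF lin]
  have cancel: "L x = L y" if "L (L x) = L (L y)" for x y
    using ker[of "x - y"] that by (simp add: L)
  have sub: "subspace (range L)" by (rule linear_subspace_image[OF lin subspace_UNIV])
  have "inj_on L (range L)" using cancel by (auto intro: inj_onI)
  then have "dim (L ` range L) = dim (range L)"
    using dim_image_eq[OF lin] span_eq_iff sub by metis
  then have rng: "L ` range L = range L"
    using subspace_dim_equal[OF linear_subspace_image[OF lin sub] sub] by auto
  have ex: "\<exists>w. w \<in> range L \<and> L (L w) = L x" for x
  proof -
    obtain z where "L x = L (L z)" using rng by blast
    moreover obtain z' where "L z = L (L z')" using rng by blast
    ultimately show ?thesis by auto
  qed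
  then obtain X where X: "\<And>x. X x \<in> range L" "\<And>x. L (L (X x)) = L x" by metis
  have unique: "X x = w" if w: "w \<in> range L" "L (L w) = L x" for x w
  proof -
    have "L (X x) = L w" using cancel[of "X x" w] X(2)[of x] w(2) by simp
    moreover obtain a where "X x = L a" using X(1)[of x] by (elim rangeE)
    moreover obtain b where "w = L b" using w(1) by (elim rangeE)
    ultimately show ?thesis using cancel by metis
  qed
  have "linear X"
    by (rule linearI; rule unique) (simp_all add: L X subspace_add[OF sub] subspace_scale[OF sub])
  moreover have "L (X (L x)) = L x" for x using cancel X(2) by blast
  moreover have "X (L (X x)) = X x" for x by (rule unique) (simp_all add: X)
  moreover have "X (L x) = L (X x)" for x by (rule unique) (simp_all add: X)
  ultimately show ?thesis by (auto simp: is_group_inverse_def fun_eq_iff)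
qed

section \<open>Irreducible Z-transformations of value zero\<close>

theorem corollary3p4:
  fixes K :: "'a::euclidean_space set" and e :: 'a and L :: "'a \<Rightarrow> 'a"
  assumes "self_dual_cone K"
    and "e \<in> interior K"
    and "linear L"
    and "Z_transformation K L"
    and "game_value K L e = 0"
    and "space_irreducible K L"
  shows "(\<forall>x. L x \<in> K \<longrightarrow> L x = 0)
    \<and> (\<forall>x. L (L x) \<in> K \<longrightarrow> L x = 0)
    \<and> {x. L (L x) = 0} = {x. L x = 0}
    \<and> (\<exists>X. is_group_inverse L X)"
proof -
  note K = assms(1) and lin = assms(3)
  obtain p where p: "p \<in> K" "L p = 0" "\<And>x. L x \<in> K \<Longrightarrow> \<exists>c. x = c *\<^sub>R p"
    using preimage_of_cone_is_line[OF K assms(2,4,6,5)] by blast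
  have almost_monotone: "L x = 0" if "L x \<in> K" for x
    using p(3)[OF that] p(2) linear_scale[OF lin] by auto
  have range_monotone: "L x = 0" if "L (L x) \<in> K" for x
  proof -
    \<comment> \<open>\<open>L x\<close> is a multiple of \<open>p\<close>, so \<open>L x\<close> or \<open>L (- x)\<close> lies in \<open>K\<close>.\<close>
    obtain c where c: "L x = c *\<^sub>R p" using p(3)[OF \<open>L (L x) \<in> K\<close>] by blast
    show ?thesis
    proof (cases "0 \<le> c")
      case True
      then show ?thesis
        using almost_monotone self_dual_cone_scaleR[OF K p(1)] c by metis
    next
      case False
      then have "(- c) *\<^sub>R p \<in> K" using self_dual_cone_scaleR[OF K p(1), of "- c"] by simp
      then have "L (- x) \<in> K" using c by (simp add: linear_neg[OF lin])
      from almost_monotone[OF this] show ?thesis by (simp add: linear_neg[OF lin])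
    qed
  qed
  have ker: "L x = 0" if "L (L x) = 0" for x
    using range_monotone[of x] that self_dual_cone_zero[OF K] by simp
  then have "{x. L (L x) = 0} = {x. L x = 0}" using linear_0[OF lin] by auto
  moreover have "\<exists>X. is_group_inverse L X" using group_inverse_exists[OF lin] ker by blast
  ultimately show ?thesis using almost_monotone range_monotone by blast
qed

end
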